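(* Let $p\ge5$ be a prime, let $H=\langle z\rangle$ be a cyclic subgroup of $G=\mathrm{SL}(2,p)$, let $x\in G$, and let $S=H\cup\{x,x^{-1}\}$, or let $x^2\in H$ and $S=H\cup(xH\cap Hx)$. If $\langle S\rangle=\mathrm{SL}(2,p)$ then $|S^3|\ge|S|^{1+\delta}$, where $\delta=\log_2(3)/3$.
   Context: For a subset $S$ of a group, $S^3=\{abc: a,b,c\in S\}$. *)

theory Defs
  imports "HOL-Computational_Algebra.Primes" "HOL-Analysis.Determinants" "HOL-Algebra.Coset" "HOL-Algebra.Generated_Groups"
begin

text \<open>SL(2,p) is obtained by taking 'f to be a field with exactly p elements,
  which is unique up to isomorphism; CARD('f) = p > 0 makes 'f finite.\<close>

definition SL2 :: "('f :: field ^ 2 ^ 2) monoid" where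
  "SL2 = \<lparr>carrier = {A. det A = 1}, monoid.mult = (**), one = mat 1\<rparr>"

lemma group_SL2: "group (SL2 :: ('f :: field ^ 2 ^ 2) monoid)"
proof (rule groupI)
  fix A :: "'f ^ 2 ^ 2" assume "A \<in> carrier SL2"
  then have d: "det A = 1" by (simp add: SL2_def)
  then have "invertible A" by (simp add: invertible_det_nz)
  then obtain B where B: "A ** B = mat 1" "B ** A = mat 1"
    by (auto simp: invertible_def)
  have "det B * det A = 1" using B(2) by (metis det_mul det_I)
  with d B(2) show "\<exists>B \<in> carrier SL2. B \<otimes>\<^bsub>SL2\<^esub> A = \<one>\<^bsub>SL2\<^esub>"
    by (auto simp: SL2_def)
qed (auto simp: SL2_def det_mul matrix_mul_assoc)

end

theory Submission imports Defs "HOL-Number_Theory.Residues" begin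

text \<open>
  Write \<open>h\<close> for the order of \<open>H\<close>. The set \<open>S\<^sup>3\<close> contains the disjoint sets \<open>H\<close> and \<open>HxH\<close>, and
  the double coset has at least \<open>h\<^sup>2 / |D|\<close> elements, where \<open>D = H \<inter> xHx\<^sup>-\<^sup>1\<close>. The heart of the
  matter is that \<open>D\<close> is central, so has at most two elements (lemma \<open>stabilizer_central\<close>). In
  \<open>SL(2,F)\<close>, with \<open>2 \<noteq> 0\<close> in \<open>F\<close>, the centre is \<open>{1, -1}\<close> and commuting is a transitive relation
  between noncentral elements. A noncentral element of \<open>D\<close> commutes with \<open>z\<close> and with
  \<open>xzx\<^sup>-\<^sup>1\<close>, so these two commute. Transitivity then propagates: since \<open>z\<close> and \<open>x\<close> generate the
  group, \<open>z\<close> commutes with every one of its conjugates, and conjugating by the two elementary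
  transvections shows that this happens only for central \<open>z\<close>
  (lemma \<open>generators_conj_not_commute\<close>).

  The set added to \<open>H\<close> has at most two elements, also in the second form of \<open>S\<close>, because
  \<open>xH \<inter> Hx = Dx\<close>. Hence \<open>|S| \<le> h + 2\<close>, and \<open>h \<ge> 3\<close> because \<open>z\<close> is neither central nor an involution. If \<open>D\<close> is
  trivial, then \<open>|S\<^sup>3| \<ge> h + h\<^sup>2\<close>. Otherwise \<open>-1 \<in> H\<close>, so \<open>h\<close> is even, and
  \<open>|S\<^sup>3| \<ge> h + h\<^sup>2/2\<close>. The exponent satisfies \<open>8 powr \<delta> = 3\<close>, so the second bound suffices
  exactly from \<open>h = 6\<close> on, with equality of the two sides there.

  This leaves \<open>h = 4\<close> with \<open>-1 \<in> H\<close>, where \<open>z\<^sup>2 = -1\<close>. Two elements with square \<open>-1\<close> cannot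
  generate the group, since modulo the centre they would generate a dihedral group, in which
  the product of the two generators is inverted by conjugation and so commutes with all its
  conjugates (lemma \<open>generators_square_not_c\<close>). This excludes the second form of \<open>S\<close>. In the first
  form it shows that \<open>x\<^sup>-\<^sup>1\<close> lies outside \<open>HxH\<close>, so \<open>S\<^sup>3\<close> contains a further double
  coset and has at least \<open>4 + 8 + 8\<close> elements.
\<close>

section \<open>Matrices of size two\<close>


lemma SL2_simps: "carrier SL2 = {A. det A = 1}" "A \<otimes>\<^bsub>SL2\<^esub> B = A ** B" "\<one>\<^bsub>SL2\<^esub> = mat 1"
  by (simp_all add: SL2_def)

lemma matrix2_eq_iff:
  fixes A B :: "'f::field^2^2"
  shows "A = B \<longleftrightarrow> A$1$1 = B$1$1 \<and> A$1$2 = B$1$2 \<and> A$2$1 = B$2$1 \<and> A$2$2 = B$2$2"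
  by (auto simp: vec_eq_iff forall_2)

lemma mult2_nth:
  fixes A B :: "'f::field^2^2"
  shows "(A ** B)$i$j = A$i$1 * B$1$j + A$i$2 * B$2$j"
  by (simp add: matrix_matrix_mult_def sum_2)

lemma finite_matrix2:
  assumes "finite (UNIV :: 'f::field set)"
  shows "finite (UNIV :: ('f^2^2) set)"
proof (rule inj_on_finite)
  show "inj_on (\<lambda>A::'f^2^2. (A$1$1, A$1$2, A$2$1, A$2$2)) UNIV"
    by (auto simp: inj_on_def matrix2_eq_iff)
  show "finite (UNIV :: ('f \<times> 'f \<times> 'f \<times> 'f) set)"
    using assms by (simp add: finite_Prod_UNIV)
qed auto

lemma two_neq_zero_if_odd_card:
  assumes "odd (CARD('f::field))"
  shows "(2::'f) \<noteq> 0"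
proof
  assume "(2::'f) = 0"
  then have "(of_nat 2 :: 'f) = 0" by simp
  then have "CHAR('f) dvd 2" by (simp only: of_nat_eq_0_iff_char_dvd)
  moreover have "CHAR('f) \<noteq> 1" by simp
  ultimately have "CHAR('f) = 2" using two_is_prime_nat by (auto simp: prime_nat_iff)
  then show False using assms CHAR_dvd_CARD[where 'a = 'f] by simp
qed

text \<open>Proportionality of vectors of length three, in the form of vanishing minors; a nonzero
  vector in the middle makes it transitive.\<close>

lemma proportional_trans:
  fixes p q r :: "'f::field"
  assumes "p \<noteq> 0 \<or> q \<noteq> 0 \<or> r \<noteq> 0"
    and "x * q = p * y" "x * r = p * t" "y * r = q * t"
    and "x' * q = p * y'" "x' * r = p * t'" "y' * r = q * t'"
  shows "x * y' = x' * y" "x * t' = x' * t" "y * t' = y' * t"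
  using assms
  by (Groebner_Basis.algebra, Groebner_Basis.algebra, Groebner_Basis.algebra)

text \<open>The entries \<open>a\<^sub>1\<^sub>2\<close>, \<open>a\<^sub>2\<^sub>1\<close> and \<open>a\<^sub>1\<^sub>1 - a\<^sub>2\<^sub>2\<close> describe a matrix up to adding a scalar
  matrix, and two matrices commute exactly when these triples are proportional.\<close>

lemma matrix2_commute_iff:
  fixes a d :: "'f::field^2^2"
  shows "a ** d = d ** a \<longleftrightarrow>
    a$1$2 * d$2$1 = d$1$2 * a$2$1 \<and>
    a$1$2 * (d$1$1 - d$2$2) = d$1$2 * (a$1$1 - a$2$2) \<and>
    a$2$1 * (d$1$1 - d$2$2) = d$2$1 * (a$1$1 - a$2$2)"
proof -
  have e: "p * P + q * R = P * p + Q * r \<longleftrightarrow> q * R = Q * r"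
    "p * Q + q * S = P * q + Q * s \<longleftrightarrow> q * (P - S) = Q * (p - s)"
    "r * P + s * R = R * p + S * r \<longleftrightarrow> r * (P - S) = R * (p - s)"
    "r * Q + s * S = R * q + S * s \<longleftrightarrow> q * R = Q * r"
    for p q r s P Q R S :: 'f
    by (Groebner_Basis.algebra, Groebner_Basis.algebra, Groebner_Basis.algebra, Groebner_Basis.algebra)
  show ?thesis unfolding matrix2_eq_iff mult2_nth e by blast
qed

lemma det1_scalar_cases:
  fixes d :: "'f::field^2^2"
  assumes "det d = 1" "d$1$2 = 0" "d$2$1 = 0" "d$1$1 = d$2$2"
  shows "d \<in> {mat 1, - mat 1}"
proof -
  have "(d$2$2 - 1) * (d$2$2 + 1) = 0"
    using assms by (simp add: det_2 algebra_simps)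
  then have "d$2$2 = 1 \<or> d$2$2 = -1"
    by (auto simp: eq_neg_iff_add_eq_0)
  then show ?thesis using assms by (auto simp: matrix2_eq_iff mat_def)
qed

lemma matrix2_commute_trans:
  fixes d a b :: "'f::field^2^2"
  assumes "det d = 1" "d \<notin> {mat 1, - mat 1}" "a ** d = d ** a" "b ** d = d ** b"
  shows "a ** b = b ** a"
proof -
  have "d$1$2 \<noteq> 0 \<or> d$2$1 \<noteq> 0 \<or> d$1$1 - d$2$2 \<noteq> 0"
    using det1_scalar_cases[of d] assms by auto
  from proportional_trans[OF this] show ?thesis
    using assms(3,4) unfolding matrix2_commute_iff by blast
qed

lemma matrix2_involution_scalar:
  fixes a :: "'f::field^2^2"
  assumes "(2::'f) \<noteq> 0" "det a = 1" "a ** a = mat 1"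
  shows "a \<in> {mat 1, - mat 1}"
proof (rule det1_scalar_cases[OF assms(2)])
  \<comment> \<open>By Cayley-Hamilton \<open>a\<^sup>2 + det a\<close> is \<open>trace a * a\<close>, so here \<open>trace a * a = 2\<close> and \<open>a\<close> is scalar.\<close>
  have e: "a$1$1*a$1$1 + a$1$2*a$2$1 = 1" "a$1$1*a$1$2 + a$1$2*a$2$2 = 0"
    "a$2$1*a$1$1 + a$2$2*a$2$1 = 0" "a$2$1*a$1$2 + a$2$2*a$2$2 = 1"
    "a$1$1*a$2$2 - a$1$2*a$2$1 = 1"
    using assms(2,3) by (simp_all add: matrix2_eq_iff mult2_nth mat_def det_2)
  have t: "(a$1$1 + a$2$2) * a$1$1 = 2" "(a$1$1 + a$2$2) * a$2$2 = 2"
  proof -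
    have "(a$1$1 + a$2$2) * a$1$1 = (a$1$1*a$1$1 + a$1$2*a$2$1) + (a$1$1*a$2$2 - a$1$2*a$2$1)"
      "(a$1$1 + a$2$2) * a$2$2 = (a$2$1*a$1$2 + a$2$2*a$2$2) + (a$1$1*a$2$2 - a$1$2*a$2$1)"
      by (simp_all add: algebra_simps)
    then show "(a$1$1 + a$2$2) * a$1$1 = 2" "(a$1$1 + a$2$2) * a$2$2 = 2"
      unfolding e by simp_all
  qed
  then have nz: "a$1$1 + a$2$2 \<noteq> 0" using assms(1) by auto
  have "(a$1$1 + a$2$2) * a$1$2 = 0" "(a$1$1 + a$2$2) * a$2$1 = 0"
    using e(2,3) by (simp_all add: algebra_simps)
  then show "a$1$2 = 0" "a$2$1 = 0" using nz by simp_all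
  have "(a$1$1 + a$2$2) * a$1$1 = (a$1$1 + a$2$2) * a$2$2" using t by simp
  then show "a$1$1 = a$2$2" using nz by simp
qed

text \<open>Commuting with its conjugate makes a nonscalar matrix an eigenvector of the conjugation, modulo
  scalars. Conjugation by a unipotent matrix has no eigenvalue other than 1, so a matrix that
  commutes with its conjugate by a transvection must commute with the transvection itself. Upper and
  lower transvections together force the matrix to be scalar. In the statement \<open>g'\<close> is the
  inverse of \<open>g\<close>.\<close>

lemma commuting_with_conjugates_scalar:
  fixes d u u' :: "'f::field^2^2"
  assumes two: "(2::'f) \<noteq> 0" and d: "det d = 1" 
    and c: "\<And>g g'. det g = 1 \<Longrightarrow> g ** g' = mat 1 \<Longrightarrow> d ** (g ** d ** g') = (g ** d ** g') ** d"
  shows "d \<in> {mat 1, - mat 1}"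
proof (rule det1_scalar_cases[OF d])
  have U: "d ** (g ** d ** g') = (g ** d ** g') ** d"
    if "g = vector [vector [1,1], vector [0,1]]" "g' = vector [vector [1,-1], vector [0,1]]" for g g'
    by (rule c) (simp_all add: that det_2 matrix2_eq_iff mult2_nth mat_def)
  have L: "d ** (g ** d ** g') = (g ** d ** g') ** d"
    if "g = vector [vector [1,0], vector [1,1]]" "g' = vector [vector [1,0], vector [-1,1]]" for g g'
    by (rule c) (simp_all add: that det_2 matrix2_eq_iff mult2_nth mat_def)
  note U' = U[OF refl refl, unfolded matrix2_commute_iff] and L' = L[OF refl refl, unfolded matrix2_commute_iff]
  show "d$2$1 = 0" using U' two by (simp add: mult2_nth)
  then show e: "d$1$1 = d$2$2" using U' by (auto simp: mult2_nth)
  show "d$1$2 = 0" using L' two by (simp add: mult2_nth)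
qed

section \<open>Conjugation, generation and double cosets in groups\<close>

context group
begin

lemma mult_inv_cancel:
  assumes "g \<in> carrier G" "y \<in> carrier G"
  shows "g \<otimes> (inv g \<otimes> y) = y" "inv g \<otimes> (g \<otimes> y) = y"
  using assms by (simp_all add: m_assoc[symmetric])

lemma conj_commute:
  assumes "g \<in> carrier G" "a \<in> carrier G" "b \<in> carrier G" "a \<otimes> b = b \<otimes> a"
  shows "(g \<otimes> a \<otimes> inv g) \<otimes> (g \<otimes> b \<otimes> inv g) = (g \<otimes> b \<otimes> inv g) \<otimes> (g \<otimes> a \<otimes> inv g)"
proof -
  have "(g \<otimes> a \<otimes> inv g) \<otimes> (g \<otimes> b \<otimes> inv g) = g \<otimes> (a \<otimes> b) \<otimes> inv g"
    and "(g \<otimes> b \<otimes> inv g) \<otimes> (g \<otimes> a \<otimes> inv g) = g \<otimes> (b \<otimes> a) \<otimes> inv g"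
    using assms(1-3) by (simp_all add: m_assoc mult_inv_cancel)
  then show ?thesis using assms(4) by simp
qed

lemma generate_sub_subgroup_eq_carrier:
  assumes "generate G A = carrier G" "A \<subseteq> K" "subgroup K G"
  shows "K = carrier G"
  using generate_subgroup_incl[OF assms(2,3)] assms(1) subgroup.subset[OF assms(3)] by auto

lemma generate_eq_carrier_mono:
  assumes "generate G A = carrier G" "B \<subseteq> carrier G" "A \<subseteq> generate G B"
  shows "generate G B = carrier G"
  using generate_sub_subgroup_eq_carrier[OF assms(1,3) generate_is_subgroup[OF assms(2)]] .

lemma generate_singleton_commute:
  assumes "z \<in> carrier G" "h \<in> generate G {z}" 
  shows "h \<otimes> z = z \<otimes> h"
  using assms(2)
proof induction
  case (eng h1 h2)
  then have "h1 \<in> carrier G" "h2 \<in> carrier G"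
    using generate_in_carrier[of "{z}"] assms(1) by auto
  then show ?case using eng assms(1) by (metis m_assoc)
qed (use assms(1) in auto)

abbreviation double_coset where
  "double_coset H x \<equiv> (\<lambda>(a, b). a \<otimes> x \<otimes> b) ` (H \<times> H)"

text \<open>The set \<open>H \<times> H\<close> maps onto \<open>HxH\<close>. The first component of a pair in a fixed fibre determines
  the second one, and first components in the same fibre differ by an element of
  \<open>H \<inter> xHx\<^sup>-\<^sup>1\<close>.\<close>

lemma card_double_coset:
  assumes H: "subgroup H G" "finite H" and x: "x \<in> carrier G"
  shows "card H * card H
       \<le> card {h \<in> H. inv x \<otimes> h \<otimes> x \<in> H} * card (double_coset H x)"
proof -
  let ?D = "{h \<in> H. inv x \<otimes> h \<otimes> x \<in> H}" and ?f = "\<lambda>(a, b). a \<otimes> x \<otimes> b"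
  have HG: "h \<in> carrier G" if "h \<in> H" for h using subgroup.mem_carrier[OF H(1) that] .
  have fib: "card {q \<in> H \<times> H. ?f q = y} \<le> card ?D" if y: "y \<in> ?f ` (H \<times> H)" for y
  proof -
    from y obtain a0 b0 where ab: "a0 \<in> H" "b0 \<in> H" "y = a0 \<otimes> x \<otimes> b0" by auto
    have key: "inv a0 \<otimes> a \<in> ?D \<and> b = inv x \<otimes> inv a \<otimes> y"
      if "a \<in> H" "b \<in> H" "a \<otimes> x \<otimes> b = y" for a b
    proof -
      have "x \<otimes> (b0 \<otimes> inv b) = inv a0 \<otimes> (a0 \<otimes> x \<otimes> b0) \<otimes> inv b"
        using that(1,2) ab(1,2) x by (simp add: m_assoc mult_inv_cancel HG)
      also have "\<dots> = inv a0 \<otimes> (a \<otimes> x \<otimes> b) \<otimes> inv b" using that(3) ab(3) by simp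
      also have "\<dots> = inv a0 \<otimes> (a \<otimes> x)"
        using that(1,2) ab(1,2) x by (simp add: m_assoc HG)
      finally have "x \<otimes> (b0 \<otimes> inv b) = inv a0 \<otimes> (a \<otimes> x)" .
      then have "inv x \<otimes> (inv a0 \<otimes> a) \<otimes> x = inv x \<otimes> (x \<otimes> (b0 \<otimes> inv b))"
        using that ab x by (simp add: m_assoc HG)
      also have "\<dots> = b0 \<otimes> inv b" using that ab x by (simp add: mult_inv_cancel HG)
      finally have "inv x \<otimes> (inv a0 \<otimes> a) \<otimes> x \<in> H"
        using that ab H(1) by (simp add: subgroup.m_closed subgroup.m_inv_closed)
      moreover have "b = inv x \<otimes> inv a \<otimes> y"
        unfolding that(3)[symmetric] using that(1,2) x by (simp add: m_assoc mult_inv_cancel HG)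
      ultimately show ?thesis
        using that ab H(1) by (simp add: subgroup.m_closed subgroup.m_inv_closed)
    qed
    have "inj_on (\<lambda>q. inv a0 \<otimes> fst q) {q \<in> H \<times> H. ?f q = y}"
    proof (rule inj_onI)
      fix q r assume q: "q \<in> {q \<in> H \<times> H. ?f q = y}" and r: "r \<in> {q \<in> H \<times> H. ?f q = y}"
        and e: "inv a0 \<otimes> fst q = inv a0 \<otimes> fst r"
      have f: "fst q = fst r" using e q r ab(1) by (auto simp: HG)
      have "snd q = inv x \<otimes> inv (fst q) \<otimes> y" "snd r = inv x \<otimes> inv (fst r) \<otimes> y"
        using key q r by auto
      then show "q = r" using f by (simp add: prod_eq_iff)
    qed
    then show ?thesis using key H(2) by (intro card_inj_on_le) auto
  qed
  have "card (H \<times> H) = card (\<Union>y \<in> ?f ` (H \<times> H). {q \<in> H \<times> H. ?f q = y})"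
    by (rule arg_cong[where f = card]) auto
  also have "\<dots> \<le> (\<Sum>y \<in> ?f ` (H \<times> H). card {q \<in> H \<times> H. ?f q = y})"
    using H(2) by (intro card_UN_le) auto
  also have "\<dots> \<le> card (?f ` (H \<times> H)) * card ?D"
    using sum_bounded_above[of "?f ` (H \<times> H)" _ "card ?D"] fib by simp
  finally show ?thesis by (simp add: card_cartesian_product mult.commute)
qed

lemma double_cosets_eq_or_disjoint:
  assumes H: "subgroup H G" and x: "x \<in> carrier G" and y: "y \<in> carrier G"
    and ne: "double_coset H x \<inter> double_coset H y \<noteq> {}"
  shows "\<exists>a\<in>H. \<exists>b\<in>H. y = a \<otimes> x \<otimes> b"
proof -
  have HG: "h \<in> carrier G" if "h \<in> H" for h using subgroup.mem_carrier[OF H(1) that] .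
  from ne obtain a b a' b' where ab: "a \<in> H" "b \<in> H" "a' \<in> H" "b' \<in> H"
    and e: "a \<otimes> x \<otimes> b = a' \<otimes> y \<otimes> b'" by auto
  have "(inv a' \<otimes> a) \<otimes> x \<otimes> (b \<otimes> inv b') = inv a' \<otimes> (a \<otimes> x \<otimes> b) \<otimes> inv b'"
    using ab x y by (simp add: m_assoc HG)
  also have "\<dots> = y" unfolding e using ab x y by (simp add: m_assoc HG mult_inv_cancel)
  finally show ?thesis
    using ab H by (intro bexI[of _ "inv a' \<otimes> a"] bexI[of _ "b \<otimes> inv b'"]) 
      (auto simp: subgroup.m_closed subgroup.m_inv_closed)
qed

end

section \<open>Groups in which commuting is transitive outside the centre\<close>

text \<open>These are the properties of \<open>SL(2,F)\<close> on which the counting rests; \<open>c\<close> stands for \<open>-1\<close>.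
  The last two conditions say that no noncentral element has an abelian normal closure, and that the
  group is not contained in \<open>{1, c}\<close>.\<close>

locale commutation_transitive_group = group G for G (structure) +
  fixes c
  assumes c_closed [simp]: "c \<in> carrier G"
    and c_central: "g \<in> carrier G \<Longrightarrow> c \<otimes> g = g \<otimes> c"
    and c_square [simp]: "c \<otimes> c = \<one>"
    and involution_central: "a \<in> carrier G \<Longrightarrow> a \<otimes> a = \<one> \<Longrightarrow> a \<in> {\<one>, c}"
    and commute_trans: "\<lbrakk>d \<in> carrier G; d \<notin> {\<one>, c}; a \<in> carrier G; b \<in> carrier G;
          a \<otimes> d = d \<otimes> a; b \<otimes> d = d \<otimes> b\<rbrakk> \<Longrightarrow> a \<otimes> b = b \<otimes> a"
    and commuting_class_central: "d \<in> carrier G \<Longrightarrow>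
          (\<And>g. g \<in> carrier G \<Longrightarrow> d \<otimes> (g \<otimes> d \<otimes> inv g) = (g \<otimes> d \<otimes> inv g) \<otimes> d) \<Longrightarrow> d \<in> {\<one>, c}"
    and not_central: "\<not> carrier G \<subseteq> {\<one>, c}"
begin

lemma c_left_cancel [simp]: "g \<in> carrier G \<Longrightarrow> c \<otimes> (c \<otimes> g) = g"
  by (simp add: m_assoc[symmetric])

lemma conj_central:
  assumes "g \<in> carrier G" "d \<in> carrier G" "g \<otimes> d \<otimes> inv g \<in> {\<one>, c}"
  shows "d \<in> {\<one>, c}"
proof -
  have "d = inv g \<otimes> (g \<otimes> d \<otimes> inv g) \<otimes> g"
    using assms(1,2) by (simp add: m_assoc mult_inv_cancel)
  moreover have "inv g \<otimes> \<one> \<otimes> g = \<one>" "inv g \<otimes> c \<otimes> g = c"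
    using assms(1) by (simp_all add: c_central[of g] m_assoc mult_inv_cancel)
  ultimately show ?thesis using assms(3) by auto
qed

text \<open>If \<open>a\<close> is noncentral, the elements \<open>g\<close> for which \<open>a\<close> commutes with \<open>gag\<^sup>-\<^sup>1\<close> form a
  subgroup: for a product \<open>gh\<close>, both \<open>a\<close> and \<open>(gh)a(gh)\<^sup>-\<^sup>1\<close> commute with the
  noncentral element \<open>gag\<^sup>-\<^sup>1\<close>. If this subgroup contains generators, \<open>a\<close> commutes with all
  its conjugates.\<close>

lemma central_if_commutes_with_conj:
  assumes a: "a \<in> carrier G" and b: "b \<in> carrier G" and gen: "generate G {a, b} = carrier G"
    and comm: "a \<otimes> (b \<otimes> a \<otimes> inv b) = (b \<otimes> a \<otimes> inv b) \<otimes> a"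
  shows "a \<in> {\<one>, c}"
proof (rule ccontr)
  assume nc: "a \<notin> {\<one>, c}"
  let ?N = "{g \<in> carrier G. a \<otimes> (g \<otimes> a \<otimes> inv g) = (g \<otimes> a \<otimes> inv g) \<otimes> a}"
  have "subgroup ?N G"
  proof (rule subgroupI)
    fix g assume g: "g \<in> ?N"
    then have "(inv g \<otimes> a \<otimes> inv (inv g)) \<otimes> (inv g \<otimes> (g \<otimes> a \<otimes> inv g) \<otimes> inv (inv g))
       = (inv g \<otimes> (g \<otimes> a \<otimes> inv g) \<otimes> inv (inv g)) \<otimes> (inv g \<otimes> a \<otimes> inv (inv g))"
      using a by (intro conj_commute) auto
    moreover have "inv g \<otimes> (g \<otimes> a \<otimes> inv g) \<otimes> inv (inv g) = a"
      using a g by (simp add: m_assoc mult_inv_cancel)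
    ultimately show "inv g \<in> ?N" using g a by simp
  next
    fix g h assume g: "g \<in> ?N" and h: "h \<in> ?N"
    let ?ag = "g \<otimes> a \<otimes> inv g" and ?ah = "h \<otimes> a \<otimes> inv h"
    have e: "g \<otimes> ?ah \<otimes> inv g = g \<otimes> h \<otimes> a \<otimes> inv (g \<otimes> h)"
      using g h a by (simp add: m_assoc inv_mult_group)
    from g h have gh: "g \<in> carrier G" "h \<in> carrier G"
      and ga: "a \<otimes> ?ag = ?ag \<otimes> a" and ha: "?ah \<otimes> a = a \<otimes> ?ah" by auto
    have cl: "?ag \<in> carrier G" "g \<otimes> ?ah \<otimes> inv g \<in> carrier G" using gh a by auto
    have "(g \<otimes> ?ah \<otimes> inv g) \<otimes> ?ag = ?ag \<otimes> (g \<otimes> ?ah \<otimes> inv g)"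
      using gh a by (intro conj_commute[OF _ _ _ ha]) auto
    moreover have "?ag \<notin> {\<one>, c}" using conj_central[of g a] gh a nc by blast
    ultimately have "a \<otimes> (g \<otimes> ?ah \<otimes> inv g) = (g \<otimes> ?ah \<otimes> inv g) \<otimes> a"
      using commute_trans[OF cl(1) _ a cl(2) ga] by blast
    then show "g \<otimes> h \<in> ?N" using gh unfolding e by blast
  qed (use a in auto)
  moreover have "{a, b} \<subseteq> ?N" using a b comm by (auto simp: m_assoc)
  ultimately have "?N = carrier G" using generate_sub_subgroup_eq_carrier[OF gen] by blast
  then show False using commuting_class_central[OF a] nc by blast
qed

lemma generators_conj_not_commute:
  assumes a: "a \<in> carrier G" and b: "b \<in> carrier G" and gen: "generate G {a, b} = carrier G"
  shows "a \<otimes> (b \<otimes> a \<otimes> inv b) \<noteq> (b \<otimes> a \<otimes> inv b) \<otimes> a"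
proof
  assume "a \<otimes> (b \<otimes> a \<otimes> inv b) = (b \<otimes> a \<otimes> inv b) \<otimes> a"
  then have A: "a \<in> {\<one>, c}" using central_if_commutes_with_conj assms by blast
  then have "a \<otimes> b = b \<otimes> a" using b c_central by auto
  \<comment> \<open>With \<open>a\<close> central, the same criterion applies to \<open>b\<close> and its conjugate by \<open>a\<close>.\<close>
  then have "a \<otimes> b \<otimes> inv a = b" using a b by (simp add: m_assoc)
  then have B: "b \<in> {\<one>, c}"
    using central_if_commutes_with_conj[of b a] a b gen by (simp add: insert_commute)
  have "inv c = c" using inv_equality[of c c] by simp
  then have "subgroup {\<one>, c} G" by (intro subgroupI) auto
  then show False using generate_sub_subgroup_eq_carrier[OF gen, of "{\<one>, c}"] A B not_central by auto
qed

lemma generators_not_commute: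
  assumes "a \<in> carrier G" "b \<in> carrier G" "generate G {a, b} = carrier G"
  shows "a \<otimes> b \<noteq> b \<otimes> a"
proof
  assume "a \<otimes> b = b \<otimes> a"
  then have "b \<otimes> a \<otimes> inv b = a" using assms by (metis inv_solve_right' m_closed)
  then show False using generators_conj_not_commute[OF assms] by simp
qed

text \<open>Conjugation by \<open>a\<close> sends \<open>ab\<close> to \<open>ba = (ab)\<^sup>-\<^sup>1\<close>, as for a rotation in a dihedral group. The pair
  \<open>ab, a\<close> generates the same group as \<open>a, b\<close>.\<close>

lemma generators_square_not_c:
  assumes a: "a \<in> carrier G" "a \<otimes> a = c" and b: "b \<in> carrier G" "b \<otimes> b = c"
    and gen: "generate G {a, b} = carrier G"
  shows False
proof -
  have ia: "inv a = c \<otimes> a"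
    using a by (intro inv_equality) (auto simp: m_assoc)
  have w: "a \<otimes> (a \<otimes> b) \<otimes> inv a = b \<otimes> a"
  proof -
    have "a \<otimes> (a \<otimes> b) \<otimes> inv a = (a \<otimes> a) \<otimes> b \<otimes> (c \<otimes> a)"
      using a(1) b(1) unfolding ia by (simp add: m_assoc)
    also have "\<dots> = b \<otimes> c \<otimes> (c \<otimes> a)" using a b by (simp add: c_central[of b])
    also have "\<dots> = b \<otimes> a" using a b by (simp add: m_assoc)
    finally show ?thesis .
  qed
  have "g \<otimes> h \<otimes> (h \<otimes> g) = \<one>"
    if "g \<in> carrier G" "g \<otimes> g = c" "h \<in> carrier G" "h \<otimes> h = c" for g h
  proof -
    have "g \<otimes> h \<otimes> (h \<otimes> g) = g \<otimes> (h \<otimes> h \<otimes> g)" using that(1,3) by (simp add: m_assoc)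
    also have "\<dots> = g \<otimes> (g \<otimes> c)" using that by (simp add: c_central[of g])
    also have "\<dots> = \<one>" using that by (simp add: m_assoc[symmetric])
    finally show ?thesis .
  qed
  then have "a \<otimes> b \<otimes> (b \<otimes> a) = \<one>" "b \<otimes> a \<otimes> (a \<otimes> b) = \<one>"
    using a b by auto
  then have "(a \<otimes> b) \<otimes> (a \<otimes> (a \<otimes> b) \<otimes> inv a) = (a \<otimes> (a \<otimes> b) \<otimes> inv a) \<otimes> (a \<otimes> b)"
    unfolding w by simp
  moreover have "generate G {a \<otimes> b, a} = carrier G"
  proof (rule generate_eq_carrier_mono[OF gen])
    have "inv a \<otimes> (a \<otimes> b) \<in> generate G {a \<otimes> b, a}"
      by (intro generate.eng generate.inv generate.incl) auto
    then show "{a, b} \<subseteq> generate G {a \<otimes> b, a}"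
      using a b by (auto simp: mult_inv_cancel intro: generate.incl)
  qed (use a b in auto)
  ultimately show False using generators_conj_not_commute[of "a \<otimes> b" a] a b by simp
qed

section \<open>A cyclic subgroup and one further generator\<close>

context
  fixes z x H
  assumes z: "z \<in> carrier G" and x: "x \<in> carrier G" and H_def: "H = generate G {z}"
    and gen: "generate G {z, x} = carrier G"
begin

lemma H_subgroup: "subgroup H G"
  unfolding H_def using generate_is_subgroup z by simp

lemma z_in_H: "z \<in> H"
  unfolding H_def by (auto intro: generate.incl)

lemma H_closed: "h \<in> H \<Longrightarrow> h \<in> carrier G"
  using subgroup.mem_carrier[OF H_subgroup] .

lemma H_commute: "h \<in> H \<Longrightarrow> h \<otimes> z = z \<otimes> h"
  unfolding H_def using generate_singleton_commute z by blast

lemma x_not_in_H: "x \<notin> H"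
  using generators_not_commute[OF z x gen] H_commute by metis

lemma z_noncentral: "z \<notin> {\<one>, c}"
  using generators_not_commute[OF z x gen] x by (auto simp: c_central[of x])

lemma x_noncentral: "x \<notin> {\<one>, c}"
  using generators_not_commute[OF z x gen] z by (auto simp: c_central[of z])

text \<open>If \<open>h\<close> lies in \<open>H\<close> and in \<open>xHx\<^sup>-\<^sup>1\<close>, it commutes with both \<open>z\<close> and \<open>xzx\<^sup>-\<^sup>1\<close>. For
  noncentral \<open>h\<close> these would then commute with each other.\<close>

lemma stabilizer_central: "{h \<in> H. inv x \<otimes> h \<otimes> x \<in> H} \<subseteq> {\<one>, c}"
proof (rule ccontr)
  assume "\<not> ?thesis"
  then obtain h where h: "h \<in> H" "inv x \<otimes> h \<otimes> x \<in> H" "h \<notin> {\<one>, c}" by blast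
  note hG = H_closed[OF h(1)]
  have "x \<otimes> (inv x \<otimes> h \<otimes> x) \<otimes> inv x = h"
    using hG x by (simp add: m_assoc mult_inv_cancel)
  then have "h \<otimes> (x \<otimes> z \<otimes> inv x) = (x \<otimes> z \<otimes> inv x) \<otimes> h"
    using conj_commute[OF x H_closed[OF h(2)] z H_commute[OF h(2)]] by simp
  then have "z \<otimes> (x \<otimes> z \<otimes> inv x) = (x \<otimes> z \<otimes> inv x) \<otimes> z"
    using commute_trans[OF hG h(3) z, of "x \<otimes> z \<otimes> inv x"] H_commute[OF h(1)] x z by simp
  then show False using generators_conj_not_commute[OF z x gen] by simp
qed

text \<open>An element \<open>x\<^sup>2 \<in> H\<close> is fixed by conjugation with \<open>x\<close>, hence central; as \<open>x\<close> is not
  central, \<open>x\<^sup>2 = c\<close>, and the dihedral obstruction applies.\<close>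

lemma square_not_in_H:
  assumes "z \<otimes> z = c"
  shows "x \<otimes> x \<notin> H"
proof
  assume "x \<otimes> x \<in> H"
  moreover have "inv x \<otimes> (x \<otimes> x) \<otimes> x = x \<otimes> x"
    using x by (simp add: mult_inv_cancel)
  ultimately have "x \<otimes> x \<in> {\<one>, c}" using stabilizer_central by auto
  then have "x \<otimes> x = c" using involution_central[OF x] x_noncentral by auto
  then show False using generators_square_not_c[OF z assms x _ gen] by simp
qed

lemma card_H_ge_3:
  assumes "finite H"
  shows "card H \<ge> 3"
proof -
  have "z \<noteq> inv z"
  proof
    assume "z = inv z"
    then have "z \<otimes> z = \<one>" using z r_inv[of z] by simp
    then show False using involution_central z z_noncentral by blast
  qed
  moreover have "inv z \<noteq> \<one>" using z z_noncentral by (metis inv_one inv_inv insertCI)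
  ultimately have "card {\<one>, z, inv z} = 3" using z_noncentral by auto
  moreover have "{\<one>, z, inv z} \<subseteq> H"
    using z_in_H subgroup.one_closed[OF H_subgroup] subgroup.m_inv_closed[OF H_subgroup] by auto
  ultimately show ?thesis using card_mono[OF assms] by metis
qed

lemma square_eq_c_if_card_4:
  assumes "card H = 4" "c \<in> H" "c \<noteq> \<one>"
  shows "z \<otimes> z = c"
proof -
  have fin: "finite H" using assms(1) by (intro card_ge_0_finite) simp
  \<comment> \<open>\<open>H\<close> consists of the four distinct elements \<open>1, c, z, cz\<close>, and \<open>z\<^sup>2\<close> can only be \<open>c\<close>.\<close>
  have "c \<otimes> z \<noteq> \<one>" "c \<otimes> z \<noteq> c"
    using z z_noncentral c_left_cancel[OF z] by (metis insertCI r_one c_closed, metis insertCI c_square)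
  moreover have "c \<otimes> z \<noteq> z" using z assms(3) by simp
  ultimately have "card {\<one>, c, z, c \<otimes> z} = 4"
    using z_noncentral assms(3) by auto
  moreover have "{\<one>, c, z, c \<otimes> z} \<subseteq> H"
    using z_in_H assms(2) subgroup.one_closed[OF H_subgroup] subgroup.m_closed[OF H_subgroup] by auto
  ultimately have "H = {\<one>, c, z, c \<otimes> z}" using card_subset_eq[OF fin] assms(1) by metis
  moreover have "z \<otimes> z \<in> H" using z_in_H subgroup.m_closed[OF H_subgroup] by blast
  ultimately have "z \<otimes> z \<in> {\<one>, c, z, c \<otimes> z}" by simp
  moreover have "z \<otimes> z \<noteq> \<one>" using involution_central z z_noncentral by blast
  moreover have "z \<otimes> z \<noteq> z" using z z_noncentral by simp
  moreover have "z \<otimes> z \<noteq> c \<otimes> z" using z z_noncentral by simp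
  ultimately show ?thesis by blast
qed

lemma even_card_H:
  assumes "c \<in> H" "c \<noteq> \<one>"
  shows "even (card H)"
proof -
  have "inv c = c" using inv_equality[of c c] by simp
  then have "subgroup {\<one>, c} G" by (intro subgroupI) auto
  then have "subgroup {\<one>, c} (G\<lparr>carrier := H\<rparr>)"
    using assms subgroup.one_closed[OF H_subgroup] by (intro subgroup_incl H_subgroup) auto
  from group.lagrange[OF subgroup_imp_group[OF H_subgroup] this]
  have "card (rcosets\<^bsub>G\<lparr>carrier := H\<rparr>\<^esub> {\<one>, c}) * 2 = card H"
    using assms(2) by (simp add: order_def)
  then show ?thesis by (metis dvd_triv_right)
qed

end

lemma generate_inv_right:
  assumes "z \<in> carrier G" "x \<in> carrier G" "generate G {z, x} = carrier G"
  shows "generate G {z, inv x} = carrier G"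
proof (rule generate_eq_carrier_mono[OF assms(3)])
  have "inv (inv x) \<in> generate G {z, inv x}" by (rule generate.inv) simp
  then show "{z, x} \<subseteq> generate G {z, inv x}" using assms by (auto intro: generate.incl)
qed (use assms in auto)

lemma generate_mult_right:
  assumes "z \<in> carrier G" "x \<in> carrier G" "generate G {z, x} = carrier G" "a \<in> generate G {z}"
  shows "generate G {z, x \<otimes> a} = carrier G"
proof (rule generate_eq_carrier_mono[OF assms(3)])
  have aG: "a \<in> carrier G" using generate_in_carrier[of "{z}"] assms by auto
  then show sub: "{z, x \<otimes> a} \<subseteq> carrier G" using assms by auto
  have "a \<in> generate G {z, x \<otimes> a}"
    using mono_generate[of "{z}" "{z, x \<otimes> a}"] assms(4) by auto
  then have "x \<otimes> a \<otimes> inv a \<in> generate G {z, x \<otimes> a}"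
    by (intro generate.eng generate.incl[of "x \<otimes> a"] generate_m_inv_closed[OF sub, of a]) simp_all
  then show "{z, x} \<subseteq> generate G {z, x \<otimes> a}" using assms aG by (auto simp: m_assoc intro: generate.incl)
qed

text \<open>From \<open>x\<^sup>-\<^sup>1 = axb\<close> it follows that \<open>(xa)\<^sup>2 = b\<^sup>-\<^sup>1a \<in> H\<close>, but \<open>xa\<close> together with \<open>z\<close>
  generates the group just as \<open>x\<close> does, so its square cannot lie in \<open>H\<close>.\<close>

lemma inv_not_in_double_coset:
  assumes z: "z \<in> carrier G" "z \<otimes> z = c" and x: "x \<in> carrier G"
    and gen: "generate G {z, x} = carrier G" and ab: "a \<in> generate G {z}" "b \<in> generate G {z}"
  shows "inv x \<noteq> a \<otimes> x \<otimes> b"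
proof
  assume e: "inv x = a \<otimes> x \<otimes> b"
  have G: "a \<in> carrier G" "b \<in> carrier G" using generate_in_carrier[of "{z}"] z ab by auto
  have sg: "subgroup (generate G {z}) G" using generate_is_subgroup z by simp
  have "(x \<otimes> a) \<otimes> (x \<otimes> a) = x \<otimes> (a \<otimes> x \<otimes> b) \<otimes> (inv b \<otimes> a)"
    using G x by (simp add: m_assoc mult_inv_cancel)
  also have "\<dots> = inv b \<otimes> a" using G x unfolding e[symmetric] by simp
  also have "\<dots> \<in> generate G {z}" using ab sg by (simp add: subgroup.m_closed subgroup.m_inv_closed)
  finally show False
    using square_not_in_H[OF z(1) _ refl generate_mult_right[OF z(1) x gen ab(1)] z(2)] x G by simp
qed

text \<open>The three alternatives come from trivial \<open>H \<inter> xHx\<^sup>-\<^sup>1\<close>, from \<open>H \<inter> xHx\<^sup>-\<^sup>1\<close> of order at most two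
  inside a group \<open>H\<close> of even order, and from the order 4, where two double cosets of size at least 8 are
  available.\<close>

theorem card_triple_product:
  assumes fin: "finite (carrier G)"
    and z: "z \<in> carrier G" and x: "x \<in> carrier G" and H: "H = generate G {z}"
    and S: "S = H \<union> {x, inv x} \<or> x \<otimes> x \<in> H \<and> S = H \<union> ((x <# H) \<inter> (H #> x))"
    and genS: "generate G S = carrier G"
  defines "n \<equiv> card (S <#> S <#> S)" and "h \<equiv> card H"
  shows "card S \<le> h + 2 \<and>
    (h \<ge> 3 \<and> h * (h + 1) \<le> n \<or> h \<ge> 6 \<and> h * (h + 2) \<le> 2 * n \<or> h = 4 \<and> 20 \<le> n)"
proof -
  let ?D = "\<lambda>x. {h \<in> H. inv x \<otimes> h \<otimes> x \<in> H}"
  have sgH: "subgroup H G" unfolding H using generate_is_subgroup z by simp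
  note one_H = subgroup.one_closed[OF sgH]
  have HG: "h \<in> carrier G" if "h \<in> H" for h using subgroup.mem_carrier[OF sgH that] .
  have finH: "finite H" using finite_subset[OF subgroup.subset[OF sgH] fin] .
  have xS: "x \<in> S"
    using S one_H x unfolding l_coset_def r_coset_def by force
  have HS: "H \<subseteq> S" using S by auto
  have SG: "S \<subseteq> carrier G" using S HG x unfolding l_coset_def by auto
  have gen: "generate G {z, x} = carrier G"
  proof (rule generate_eq_carrier_mono[OF genS])
    show sub: "{z, x} \<subseteq> carrier G" using z x by simp
    have H': "H \<subseteq> generate G {z, x}" unfolding H by (rule mono_generate) simp
    have x': "x \<in> generate G {z, x}" by (rule generate.incl) simp
    then show "S \<subseteq> generate G {z, x}"
      using S H' generate_m_inv_closed[OF sub x'] generate.eng[OF x'] unfolding l_coset_def by auto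
  qed
  note gen' = generate_inv_right[OF z x gen]
  note D = stabilizer_central[OF z x H gen]
    and D' = stabilizer_central[OF z inv_closed[OF x] H gen']
  have card_D: "card (?D y) \<le> card {\<one>, c}" if "?D y \<subseteq> {\<one>, c}" for y
    using that by (intro card_mono) auto
  have card2: "card {\<one>, c} \<le> 2" by (simp add: card_insert_if)
  have fin3: "finite (S <#> S <#> S)"
    using SG by (intro finite_subset[OF _ fin] set_mult_closed)
  have in3: "a \<otimes> b \<otimes> d \<in> S <#> S <#> S" if "a \<in> S" "b \<in> S" "d \<in> S" for a b d
    using that unfolding set_mult_def by blast
  have H3: "H \<subseteq> S <#> S <#> S"
  proof
    fix h assume "h \<in> H"
    then show "h \<in> S <#> S <#> S" using in3[of h \<one> \<one>] one_H HS HG by auto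
  qed
  have X3: "double_coset H y \<subseteq> S <#> S <#> S" if "y \<in> S" for y
    using that HS by (auto intro!: in3)
  have disj1: "H \<inter> double_coset H y = {}" if y: "y \<in> carrier G" "y \<notin> H" for y
  proof (rule ccontr)
    assume "H \<inter> double_coset H y \<noteq> {}"
    moreover have "H \<subseteq> double_coset H \<one>"
      using one_H HG by (force intro!: image_eqI[of _ _ "(_, \<one>)"])
    ultimately have "double_coset H \<one> \<inter> double_coset H y \<noteq> {}" by blast
    from double_cosets_eq_or_disjoint[OF sgH one_closed y(1) this]
    show False using y(2) HG sgH by (auto simp: subgroup.m_closed)
  qed
  have xH: "x \<notin> H" using x_not_in_H[OF z x H gen] .
  have finC: "finite (double_coset H y)" for y using finH by simp
  have lower: "h + card (double_coset H x) \<le> n"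
  proof -
    have "h + card (double_coset H x) = card (H \<union> double_coset H x)"
      unfolding h_def by (intro card_Un_disjoint[symmetric] finH finC disj1 x xH)
    also have "\<dots> \<le> n" unfolding n_def by (intro card_mono fin3 Un_least H3 X3 xS)
    finally show ?thesis .
  qed
  \<comment> \<open>Right multiplication by \<open>x\<^sup>-\<^sup>1\<close> carries \<open>xH \<inter> Hx\<close> into \<open>H \<inter> xHx\<^sup>-\<^sup>1\<close>.\<close>
  have cS: "card S \<le> h + 2"
  proof -
    have "card ((x <# H) \<inter> (H #> x)) \<le> card (?D x)"
    proof (rule card_inj_on_le[where f = "\<lambda>w. w \<otimes> inv x"])
      show "inj_on (\<lambda>w. w \<otimes> inv x) ((x <# H) \<inter> (H #> x))"
        using x HG by (auto simp: inj_on_def l_coset_def)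
      show "(\<lambda>w. w \<otimes> inv x) ` ((x <# H) \<inter> (H #> x)) \<subseteq> ?D x"
      proof (rule image_subsetI)
        fix w assume "w \<in> (x <# H) \<inter> (H #> x)"
        then obtain h k where hk: "h \<in> H" "k \<in> H" and w: "w = h \<otimes> x" "w = x \<otimes> k"
          unfolding l_coset_def r_coset_def by blast
        have "w \<otimes> inv x = h" unfolding w(1) using hk x HG by (simp add: m_assoc)
        moreover have "inv x \<otimes> (h \<otimes> x) = k"
          unfolding w(1)[symmetric] w(2) using hk x HG by (simp add: mult_inv_cancel)
        ultimately show "w \<otimes> inv x \<in> ?D x" using hk x HG by (simp add: m_assoc)
      qed
    qed (use finH in auto)
    then have "card ((x <# H) \<inter> (H #> x)) \<le> 2" using card_D[OF D] card2 by simp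
    moreover have "card {x, inv x} \<le> 2" by (simp add: card_insert_if)
    ultimately show ?thesis
      using S card_Un_le[of H "{x, inv x}"] card_Un_le[of H "(x <# H) \<inter> (H #> x)"]
      unfolding h_def by auto
  qed
  have h3: "h \<ge> 3" unfolding h_def using card_H_ge_3[OF z x H gen finH] .
  have coset: "h * h \<le> card (?D y) * card (double_coset H y)" if "y \<in> carrier G" for y
    unfolding h_def by (rule card_double_coset[OF sgH finH that])
  show ?thesis
  proof (cases "c \<in> H \<and> c \<noteq> \<one>")
    case False
    then have "?D x \<subseteq> {\<one>}" using D by blast
    then have "card (?D x) \<le> 1" using card_mono[of "{\<one>}" "?D x"] by simp
    then have "h * h \<le> card (double_coset H x)"
      using le_trans[OF coset[OF x] mult_le_mono1] by fastforce
    then have "h * (h + 1) \<le> n" using lower by simp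
    then show ?thesis using cS h3 by simp
  next
    case True
    have coset2: "h * h \<le> 2 * card (double_coset H y)" if "y \<in> carrier G" "?D y \<subseteq> {\<one>, c}" for y
      by (rule le_trans[OF coset[OF that(1)] mult_le_mono1[OF le_trans[OF card_D[OF that(2)] card2]]])
    have "even h" unfolding h_def using even_card_H[OF z x H gen] True by blast
    then have "h \<noteq> 3" "h \<noteq> 5" by auto
    then consider "h \<ge> 6" | "h = 4" using h3 by linarith
    then show ?thesis
    proof cases
      case 1
      then show ?thesis using cS lower coset2[OF x D] by (simp add: algebra_simps)
    next
      case 2
      have zz: "z \<otimes> z = c"
        using square_eq_c_if_card_4[OF z x H gen] 2 True unfolding h_def by blast
      have "inv x \<in> S"
        using S square_not_in_H[OF z x H gen zz] by blast
      have "inv x \<notin> H" using xH subgroup.m_inv_closed[OF sgH, of "inv x"] x by auto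
      have disj2: "double_coset H x \<inter> double_coset H (inv x) = {}"
        using double_cosets_eq_or_disjoint[OF sgH x inv_closed[OF x]]
          inv_not_in_double_coset[OF z zz x gen] unfolding H by blast
      have "h + card (double_coset H x) + card (double_coset H (inv x))
          = card (H \<union> double_coset H x) + card (double_coset H (inv x))"
        unfolding h_def using card_Un_disjoint[OF finH finC disj1[OF x xH]] by simp
      also have "\<dots> = card (H \<union> double_coset H x \<union> double_coset H (inv x))"
        using disj1[OF inv_closed[OF x] \<open>inv x \<notin> H\<close>] disj2
        by (intro card_Un_disjoint[symmetric] finite_UnI finH finC) blast
      also have "\<dots> \<le> n"
        unfolding n_def by (intro card_mono fin3 Un_least H3 X3 xS \<open>inv x \<in> S\<close>)
      finally show ?thesis
        using cS 2 coset2[OF x D] coset2[OF inv_closed[OF x] D'] by simp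
    qed
  qed
qed

end

section \<open>The exponent\<close>

text \<open>With \<open>t = h + 2\<close> the claim is an upper bound for \<open>t powr \<delta>\<close>. Since \<open>8 powr \<delta> = 3\<close> and
  \<open>0 \<le> \<delta> \<le> 1\<close>, one has \<open>t powr \<delta> \<le> 3t/8 \<le> h/2\<close> for \<open>t \<ge> 8\<close>, and \<open>t powr \<delta> \<le> 3\<close> below; the
  second bound is too weak only for \<open>h = 3\<close>, where \<open>5 powr \<delta> \<le> 12/5\<close> is required.\<close>

lemma powr_le_triple_product_bounds:
  fixes \<delta> :: real and s :: nat
  assumes "\<delta> = log 2 3 / 3" "s \<le> h + 2"
    and "h \<ge> 3 \<and> h * (h + 1) \<le> n \<or> h \<ge> 6 \<and> h * (h + 2) \<le> 2 * n \<or> h = 4 \<and> 20 \<le> n"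
  shows "real s powr (1 + \<delta>) \<le> real n"
proof -
  have d0: "\<delta> \<ge> 0" unfolding assms(1) by simp
  have two: "(2::real) powr (3 * \<delta>) = 3" unfolding assms(1) by simp
  have eight: "(8::real) powr \<delta> = 3"
    using two powr_powr[of 2 3 \<delta>] by simp
  have d1: "\<delta> \<le> 1" unfolding assms(1) by (simp add: log_le_iff)
  have five: "(5::real) powr \<delta> \<le> 12 / 5"
  proof (rule power_le_imp_le_base)
    \<comment> \<open>\<open>5\<^sup>3 \<le> 2\<^sup>7\<close> and \<open>2 powr (3 * \<delta>) = 3\<close> bound the ninth power by \<open>3\<^sup>7\<close>.\<close>
    have "((5::real) powr \<delta>) ^ Suc 8 = (5 powr 3) powr (3 * \<delta>)"
      by (simp only: powr_power powr_powr) simp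
    also have "\<dots> \<le> (2 powr 7) powr (3 * \<delta>)"
      using d0 by (intro powr_mono2) simp_all
    also have "\<dots> = (2 powr (3 * \<delta>)) ^ 7"
      by (simp only: powr_power powr_powr) (simp add: mult.commute)
    also have "\<dots> \<le> (12 / 5) ^ Suc 8"
      unfolding two by (simp add: field_simps)
    finally show "((5::real) powr \<delta>) ^ Suc 8 \<le> (12 / 5) ^ Suc 8" .
  qed simp
  have large: "t powr \<delta> \<le> 3 * t / 8" if "t \<ge> 8" for t :: real
  proof -
    have "(t / 8) powr \<delta> \<le> (t / 8) powr 1" using that d1 by (intro powr_mono) auto
    moreover have "t powr \<delta> = 3 * (t / 8) powr \<delta>"
      using that eight powr_mult[of 8 "t / 8" \<delta>] by simp
    ultimately show ?thesis using that by simp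
  qed
  have small: "t powr \<delta> \<le> 3" if "0 \<le> t" "t \<le> 8" for t :: real
    using powr_mono2[OF d0 that] eight by simp
  let ?t = "real h + 2"
  have "real s powr (1 + \<delta>) \<le> ?t powr (1 + \<delta>)"
    using assms(2) d0 by (intro powr_mono2) auto
  also have "\<dots> = ?t * ?t powr \<delta>" by (simp add: powr_add)
  also have "\<dots> \<le> real n"
    using assms(3)
  proof (elim disjE conjE)
    assume h: "h \<ge> 6" "h * (h + 2) \<le> 2 * n"
    have "real h * ?t \<le> 2 * real n" using of_nat_mono[OF h(2), where 'a = real] by (simp add: algebra_simps)
    moreover have "?t * ?t powr \<delta> \<le> ?t * (real h / 2)"
      using large[of ?t] h(1) by (intro mult_left_mono) auto
    ultimately show ?thesis by (simp add: algebra_simps)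
  next
    assume "h = 4" "20 \<le> n"
    then show ?thesis using small[of 6] by simp
  next
    assume h: "3 \<le> h" "h * (h + 1) \<le> n"
    have n: "real h * (real h + 1) \<le> real n" using of_nat_mono[OF h(2), where 'a = real] by (simp add: algebra_simps)
    consider "h = 3" | "h = 4" | "h = 5" | "h \<ge> 6" using h(1) by linarith
    then show ?thesis
    proof cases
      case 1 then show ?thesis using five n by simp
    next
      case 2 then show ?thesis using small[of 6] n by simp
    next
      case 3 then show ?thesis using small[of 7] n by simp
    next
      case 4
      have "?t * ?t powr \<delta> \<le> ?t * (real h / 2)"
        using large[of ?t] 4 by (intro mult_left_mono) auto
      also have "\<dots> \<le> real h * (real h + 1)" by (simp add: algebra_simps)
      finally show ?thesis using n by simp
    qed
  qed
  finally show ?thesis .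
qed


section \<open>The special linear group\<close>

lemma SL2_commutation_transitive:
  assumes two: "(2::'f::field) \<noteq> 0"
  shows "commutation_transitive_group (SL2 :: ('f^2^2) monoid) (- mat 1)"
proof (intro commutation_transitive_group.intro commutation_transitive_group_axioms.intro group_SL2;
    (simp only: SL2_simps mem_Collect_eq)?)
  fix A :: "'f^2^2"
  show "- mat 1 ** A = A ** - mat 1" by (simp add: matrix2_eq_iff mult2_nth mat_def)
next
  fix A :: "'f^2^2"
  assume "det A = 1" "A ** A = mat 1"
  then show "A \<in> {mat 1, - mat 1}" by (rule matrix2_involution_scalar[OF two])
next
  fix D A B :: "'f^2^2"
  assume "det D = 1" "D \<notin> {mat 1, - mat 1}" "A ** D = D ** A" "B ** D = D ** B"
  then show "A ** B = B ** A" by (rule matrix2_commute_trans)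
next
  fix D :: "'f^2^2"
  assume D: "det D = 1" and 
    c: "\<And>g. det g = 1 \<Longrightarrow> D ** (g ** D ** inv\<^bsub>SL2\<^esub> g) = g ** D ** inv\<^bsub>SL2\<^esub> g ** D"
  show "D \<in> {mat 1, - mat 1}"
  proof (rule commuting_with_conjugates_scalar[OF two D])
    fix g g' :: "'f^2^2"
    assume g: "det g = 1" "g ** g' = mat 1"
    have "g' = inv\<^bsub>SL2\<^esub> g"
    proof -
      have "det g' = 1" using g by (metis det_I det_mul mult_1)
      then show ?thesis
        using group.inv_equality[OF group_SL2, of g' g] g
        by (simp add: SL2_simps matrix_left_right_inverse)
    qed
    then show "D ** (g ** D ** g') = g ** D ** g' ** D" using c[OF g(1)] by simp
  qed
next
  let ?u = "vector [vector [1,1], vector [0,1]] :: 'f^2^2"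
  have "det ?u = 1" "?u \<noteq> mat 1" "?u \<noteq> - mat 1"
    by (simp_all add: det_2 matrix2_eq_iff mat_def)
  then show "\<not> {A :: 'f^2^2. det A = 1} \<subseteq> {mat 1, - mat 1}" by blast
qed (simp_all add: det_2 matrix2_eq_iff mult2_nth mat_def)

theorem proposition4p2:
  fixes p :: nat
    and G :: "('f :: field ^ 2 ^ 2) monoid"
    and z x :: "'f ^ 2 ^ 2"
    and H S :: "('f ^ 2 ^ 2) set"
    and \<delta> :: real
  assumes "Factorial_Ring.prime p" and "p \<ge> 5" and "CARD('f) = p"
    and "G = SL2"
    and "z \<in> carrier G" and "H = generate G {z}"
    and "x \<in> carrier G"
    and "S = H \<union> {x, inv\<^bsub>G\<^esub> x} \<or>
         x [^]\<^bsub>G\<^esub> (2::nat) \<in> H \<and> S = H \<union> ((x <#\<^bsub>G\<^esub> H) \<inter> (H #>\<^bsub>G\<^esub> x))"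
    and "generate G S = carrier G"
    and "\<delta> = log 2 3 / 3"
  shows "real (card (S <#>\<^bsub>G\<^esub> S <#>\<^bsub>G\<^esub> S)) \<ge> real (card S) powr (1 + \<delta>)"
proof -
  have "odd (CARD('f))" using assms(1-3) prime_odd_nat[of p] by simp
  then interpret commutation_transitive_group G "- mat 1"
    using SL2_commutation_transitive[OF two_neq_zero_if_odd_card] assms(4) by blast
  have "finite (UNIV :: 'f set)" using assms(2,3) by (intro card_ge_0_finite) simp
  then have "finite (carrier G)" using finite_matrix2 finite_subset subset_UNIV by blast
  moreover have "x [^]\<^bsub>G\<^esub> (2::nat) = x \<otimes>\<^bsub>G\<^esub> x"
    using assms(7) by (simp add: numeral_2_eq_2)
  ultimately have "card S \<le> card H + 2 \<and>
    (card H \<ge> 3 \<and> card H * (card H + 1) \<le> card (S <#>\<^bsub>G\<^esub> S <#>\<^bsub>G\<^esub> S) \<or>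
     card H \<ge> 6 \<and> card H * (card H + 2) \<le> 2 * card (S <#>\<^bsub>G\<^esub> S <#>\<^bsub>G\<^esub> S) \<or>
     card H = 4 \<and> 20 \<le> card (S <#>\<^bsub>G\<^esub> S <#>\<^bsub>G\<^esub> S))"
    using assms(8) by (intro card_triple_product[OF _ assms(5,7,6) _ assms(9)]) simp_all
  then show ?thesis using powr_le_triple_product_bounds[OF assms(10)] by blast
qed

end
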